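(* Let $\sigma>1$. Let $(n_1,n_2)=(n_1(m),n_2(m))_{m\ge 1}$ be a sequence of pairs of positive integers such that $n:=n_1+n_2\to\infty$ as $m\to\infty$; all limits and asymptotic relations below are along this sequence and are written "as $n\to\infty$". For each such pair let $X_1,\dots,X_{n_1}$ be $N(0,1)$ random variables and $X_{n_1+1},\dots,X_{n_1+n_2}$ be $N(0,\sigma^2)$ random variables, all mutually independent, and put $$M^{(1)}_{n_1}:=\max_{1\le i\le n_1}X_i,\qquad M^{(2)}_{n_2}:=\max_{n_1+1\le i\le n}X_i .$$ Then the sequence $\mathbb P\bigl(M^{(1)}_{n_1}>M^{(2)}_{n_2}\bigr)$ converges to a limit in $(0,1)$ if and only if there is a constant $C\in(0,\infty)$ such that $$n_1\sim C\,n_2^{\sigma^2}(\log n_2)^{-(\sigma^2-1)/2}\qquad\text{as } n\to\infty .$$ Moreover, in this case, $$\lim_{n\to\infty}\mathbb P\bigl(M^{(1)}_{n_1}>M^{(2)}_{n_2}\bigr)=\mathbb P\bigl(\Lambda_1>\sigma^2(\Lambda_2-\kappa(C,\sigma))\bigr)=\int_0^\infty \exp\Bigl(-y-e^{-\kappa(C,\sigma)}\,y^{1/\sigma^2}\Bigr)\,\mathrm dy,$$ where $\Lambda_1$ and $\Lambda_2$ are independent Gumbel random variables and $$\kappa(C,\sigma)=\frac{1}{\sigma^2}\log\frac{C}{\sigma}+\frac12\Bigl(1-\frac1{\sigma^2}\Bigr)\log(4\pi).$$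
   Context: A Gumbel random variable is one with distribution function $F_\Lambda(x)=\exp(-e^{-x})$, $x\in\mathbb R$. The notation $u\sim v$ means $u/v\to1$ along the sequence considered; in the relation $n_1\sim C n_2^{\sigma^2}(\log n_2)^{-(\sigma^2-1)/2}$ it is understood that $n_2\ge 2$ for all sufficiently large indices, so that the right-hand side is well defined. $N(0,s^2)$ denotes the centered Gaussian distribution with variance $s^2$, and $\log$ is the natural logarithm. *)

theory Defs
  imports "HOL-Probability.Probability" "HOL-Library.Landau_Symbols"
begin

definition gumbel_variable :: "'a measure \<Rightarrow> ('a \<Rightarrow> real) \<Rightarrow> bool" where
  "gumbel_variable M L \<longleftrightarrow>
     L \<in> borel_measurable M \<and> (\<forall>x. cdf (distr M borel L) x = exp (- exp (- x)))"

definition kappa :: "real \<Rightarrow> real \<Rightarrow> real" where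
  "kappa C \<sigma> = 1 / \<sigma>\<^sup>2 * ln (C / \<sigma>) + 1 / 2 * (1 - 1 / \<sigma>\<^sup>2) * ln (4 * pi)"

text \<open>
  The first conjunct excludes \<open>ln (n2 m) = 0\<close>, where the comparison sequence has no
  mathematical meaning (in HOL it would take the value \<open>0\<close>).
\<close>

definition critical_growth :: "real \<Rightarrow> real \<Rightarrow> (nat \<Rightarrow> nat) \<Rightarrow> (nat \<Rightarrow> nat) \<Rightarrow> bool" where
  "critical_growth \<sigma> C n1 n2 \<longleftrightarrow>
     (\<forall>\<^sub>F m in sequentially. 2 \<le> n2 m) \<and>
     asymp_equiv (\<lambda>m. real (n1 m)) sequentially
       (\<lambda>m. C * real (n2 m) powr (\<sigma>\<^sup>2) * ln (real (n2 m)) powr (- ((\<sigma>\<^sup>2 - 1) / 2)))"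

end

theory Submission
  imports Defs "HOL-Real_Asymp.Real_Asymp"
begin

text \<open>
  Write \<open>\<Phi>\<close> for the standard normal distribution function and \<open>H = - ln \<Phi>\<close>, a decreasing
  bijection from the reals onto the positive reals.  The maximum of the first sample has
  distribution function \<open>exp (- n\<^sub>1 H x)\<close>, so it is distributed like the value at a standard
  exponential variable \<open>Y\<close> of the inverse of \<open>n\<^sub>1 H\<close>; the maximum of the second sample has
  distribution function \<open>exp (- n\<^sub>2 H (x / \<sigma>))\<close>.  Conditioning on \<open>Y\<close> gives, for all sample sizes,
  that the first sample wins with probability \<open>E (exp (- n\<^sub>2 T (Y / n\<^sub>1)))\<close>, where
  \<open>T s = H (H\<^sup>-\<^sup>1 s / \<sigma>)\<close> (lemmas \<open>prob_less_eq_integral_exp_law\<close>, \<open>prob_max_greater\<close>).  The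
  same formula evaluates the Gumbel probability (lemma \<open>gumbel_race\<close>).

  Mills' ratio \<open>H x \<sim> \<phi> x / x\<close> yields
  \<open>T s \<sim> \<sigma> (4 \<pi> ln (1 / s)) powr (- b) * s powr a\<close> as \<open>s\<close> tends to \<open>0\<close>, with
  \<open>a = 1 / \<sigma>\<^sup>2\<close> and \<open>b = (1 - a) / 2\<close> (lemma \<open>ln_tail_transfer_asymp\<close>).  In particular \<open>T\<close> varies
  regularly, \<open>T (y / n\<^sub>1) / T (1 / n\<^sub>1) \<longlongrightarrow> y powr a\<close>, so when \<open>n\<^sub>1\<close> tends to infinity everything depends
  on the single number \<open>d = n\<^sub>2 T (1 / n\<^sub>1)\<close>: if \<open>d \<longlongrightarrow> c\<close>, then the probability tends to
  \<open>I c = E (exp (- c Y powr a))\<close> by dominated convergence.  Since \<open>I\<close> decreases strictly and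
  continuously from \<open>1\<close> to \<open>0\<close>, a monotonicity squeeze shows the converse: convergence to a limit
  in \<open>(0, 1)\<close> forces \<open>d\<close> to converge to a positive number (lemma \<open>race_rate_tendsto\<close>).  That
  \<open>n\<^sub>1\<close> tends to infinity in this case holds because, for bounded \<open>n\<^sub>1\<close>, a huge second sample wins
  with probability close to \<open>1\<close> (lemma \<open>first_sample_at_top\<close>).

  It remains to see that convergence of \<open>d\<close> to a positive number is the stated growth condition.  In
  the logarithms \<open>u = ln n\<^sub>1\<close> and \<open>v = ln n\<^sub>2\<close> the former says that \<open>v - a u - b ln u\<close> converges,
  the latter that \<open>u - \<sigma>\<^sup>2 v + \<sigma>\<^sup>2 b ln v\<close> converges.  As \<open>n\<^sub>1 + n\<^sub>2\<close> diverges, the growth condition lets both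
  sizes tend to infinity (lemma \<open>critical_growth_second_sample_at_top\<close>).  Either convergence forces
  \<open>ln v - ln u \<longlongrightarrow> ln a\<close> (lemma \<open>log_balance\<close>), and modulo this relation the two expressions are multiples of each other.
  Following the constants gives \<open>c = exp (- kappa C \<sigma>)\<close>.
\<close>

section \<open>Comparing independent variables through an exponential variable\<close>

definition exp_law :: "real measure" where
  "exp_law = density lborel (exponential_density 1)"

lemma sets_exp_law [simp, measurable_cong]: "sets exp_law = sets borel"
  by (simp add: exp_law_def)

lemma space_exp_law [simp]: "space exp_law = UNIV"
  by (simp add: exp_law_def)

lemma prob_space_exp_law: "prob_space exp_law"
  unfolding exp_law_def by (rule prob_space_exponential_density) simp

interpretation exp_law: prob_space exp_law
  by (rule prob_space_exp_law)

lemma AE_exp_law_pos: "AE y in exp_law. 0 < y"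
proof -
  have "AE y in lborel. y \<noteq> (0::real)"
    by (rule AE_lborel_singleton)
  then show ?thesis
    unfolding exp_law_def
    by (subst AE_density) (auto simp: exponential_density_def elim!: eventually_mono)
qed

lemma integral_exp_law:
  fixes f :: "real \<Rightarrow> real"
  assumes [measurable]: "f \<in> borel_measurable borel"
  shows "(\<integral>y. f y \<partial>exp_law) = (LBINT y:{0..}. exp (- y) * f y)"
  unfolding exp_law_def set_lebesgue_integral_def
  by (subst integral_density)
     (auto simp: exponential_density_nonneg exponential_density_def indicator_def
           intro!: Bochner_Integration.integral_cong)

lemma exp_law_atLeast:
  assumes "0 \<le> t"
  shows "measure exp_law {t..} = exp (- t)"
proof -
  have D: "distributed exp_law lborel (\<lambda>y. y) (exponential_density 1)"
    unfolding distributed_def by (auto simp: exp_law_def distr_id2 exponential_density_nonneg)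
  have "measure exp_law {t..} = measure exp_law {t<..}"
  proof (rule measure_eq_AE)
    have "AE y in exp_law. y \<noteq> t" unfolding exp_law_def
      by (subst AE_density) (auto intro: AE_mp[OF AE_lborel_singleton[of t]])
    then show "AE x in exp_law. (x \<in> {t..}) = (x \<in> {t<..})" by eventually_elim auto
  qed auto
  also have "\<dots> = exp (- t)"
    using exp_law.exponential_distributedD_gt[OF D assms] by (simp add: greaterThan_def)
  finally show ?thesis .
qed

text \<open>
  The total mass is finite, so a constant dominates.  Only positive arguments are considered
  because the integrands involve functions, such as \<open>nlogPhi_inv\<close>, that are meaningful only there.
\<close>

lemma integral_exp_law_tendsto:
  fixes f :: "nat \<Rightarrow> real \<Rightarrow> real"
  assumes [measurable]: "\<And>m. f m \<in> borel_measurable borel" "g \<in> borel_measurable borel"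
    and lim: "\<And>y. 0 < y \<Longrightarrow> (\<lambda>m. f m y) \<longlonglongrightarrow> g y"
    and bnd: "\<And>m y. 0 < y \<Longrightarrow> \<bar>f m y\<bar> \<le> 1"
  shows "(\<lambda>m. \<integral>y. f m y \<partial>exp_law) \<longlonglongrightarrow> (\<integral>y. g y \<partial>exp_law)"
proof (rule integral_dominated_convergence[where w="\<lambda>_. 1"])
  show "AE y in exp_law. (\<lambda>m. f m y) \<longlonglongrightarrow> g y"
    using AE_exp_law_pos by eventually_elim (rule lim)
  show "AE y in exp_law. norm (f m y) \<le> 1" for m
    using AE_exp_law_pos by eventually_elim (simp add: bnd)
qed auto

text \<open>
  Sublevel sets of the inverse of a decreasing function are half-lines, here of positive numbers;
  off this domain \<open>k\<close> is replaced by a constant, as its values there are arbitrary.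
\<close>

lemma measurable_antimono_inverse:
  fixes K k :: "real \<Rightarrow> real"
  assumes anti: "\<And>x x'. K x \<le> K x' \<longleftrightarrow> x' \<le> x"
    and pos: "\<And>x. 0 < K x"
    and inv: "\<And>y. 0 < y \<Longrightarrow> K (k y) = y"
  shows "(\<lambda>y. if 0 < y then k y else 0) \<in> borel_measurable borel"
proof (subst borel_measurable_iff_le, safe)
  fix x
  have le_iff: "k y \<le> x \<longleftrightarrow> K x \<le> y" if "0 < y" for y
    using anti[of x "k y"] inv[OF that] by simp
  have "{w \<in> space borel. (if 0 < w then k w else 0) \<le> x} = {K x..} \<union> (if 0 \<le> x then {..0} else {})"
    using le_iff pos[of x] by (auto split: if_splits)
  then show "{w \<in> space borel. (if 0 < w then k w else 0) \<le> x} \<in> sets borel" by simp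
qed

text \<open>
  Inverse transform sampling, in the scale where the uniform variable \<open>F A\<close> is replaced by the
  exponential variable \<open>- ln (F A) = K A\<close>.
\<close>

lemma distr_exp_law:
  fixes A :: "'a \<Rightarrow> real" and K k :: "real \<Rightarrow> real"
  assumes "prob_space M" and [measurable]: "A \<in> borel_measurable M" "k \<in> borel_measurable borel"
    and cdf: "\<And>x. cdf (distr M borel A) x = exp (- K x)"
    and anti: "\<And>x x'. K x \<le> K x' \<longleftrightarrow> x' \<le> x"
    and pos: "\<And>x. 0 < K x"
    and inv: "\<And>y. 0 < y \<Longrightarrow> K (k y) = y"
  shows "distr M borel A = distr exp_law borel k"
proof (rule cdf_unique)
  interpret M: prob_space M by fact
  show "real_distribution (distr M borel A)" "real_distribution (distr exp_law borel k)"
    by (simp_all add: exp_law.real_distribution_distr)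
  show "cdf (distr M borel A) = cdf (distr exp_law borel k)"
  proof
    fix x
    have "cdf (distr exp_law borel k) x = measure exp_law {y. k y \<le> x}"
      by (simp add: cdf_def measure_distr vimage_def)
    also have "\<dots> = measure exp_law {K x..}"
    proof (rule measure_eq_AE)
      show "AE y in exp_law. (y \<in> {y. k y \<le> x}) = (y \<in> {K x..})"
        using AE_exp_law_pos
      proof eventually_elim
        case (elim y)
        then show ?case using anti[of x "k y"] inv[of y] by simp
      qed
    qed simp_all
    also have "\<dots> = exp (- K x)"
      using pos[of x] by (intro exp_law_atLeast) simp
    finally show "cdf (distr M borel A) x = cdf (distr exp_law borel k) x"
      using cdf by simp
  qed
qed

text \<open>
  By independence the probability is the mean of \<open>G A\<close>; continuity of \<open>G\<close> removes the difference
  between \<open>B < x\<close> and \<open>B \<le> x\<close>.  With \<open>K\<close> a multiple of \<open>- ln \<Phi>\<close> this handles normal maxima,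
  with \<open>K\<close> an exponential function it handles Gumbel variables.  The weight is exponential and
  thus independent of the sample sizes, so that limits may be taken under the integral.
\<close>

lemma prob_less_eq_integral_exp_law:
  fixes A B :: "'a \<Rightarrow> real" and K k G :: "real \<Rightarrow> real"
  assumes "prob_space M" and indep: "prob_space.indep_var M borel A borel B"
    and k [measurable]: "k \<in> borel_measurable borel"
    and cdf_A: "\<And>x. cdf (distr M borel A) x = exp (- K x)"
    and anti: "\<And>x x'. K x \<le> K x' \<longleftrightarrow> x' \<le> x"
    and pos: "\<And>x. 0 < K x"
    and inv: "\<And>y. 0 < y \<Longrightarrow> K (k y) = y"
    and cdf_B: "\<And>x. cdf (distr M borel B) x = G x"
    and cont: "\<And>x. isCont G x"
  shows "\<P>(\<omega> in M. B \<omega> < A \<omega>) = (\<integral>y. G (k y) \<partial>exp_law)"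
proof -
  interpret M: prob_space M by fact
  have [measurable]: "A \<in> borel_measurable M" "B \<in> borel_measurable M"
    using indep M.indep_var_rv1 M.indep_var_rv2 by blast+
  have [measurable]: "G \<in> borel_measurable borel"
    by (intro borel_measurable_continuous_onI continuous_at_imp_continuous_on) (use cont in blast)
  define \<mu> \<nu> where "\<mu> = distr M borel A" and "\<nu> = distr M borel B"
  interpret \<mu>: prob_space \<mu> unfolding \<mu>_def by (rule M.prob_space_distr) simp
  interpret \<nu>: real_distribution \<nu> unfolding \<nu>_def by (rule M.real_distribution_distr) simp
  have [measurable_cong]: "sets \<mu> = sets borel" "sets \<nu> = sets borel"
    by (simp_all add: \<mu>_def \<nu>_def)
  have sp: "space (\<mu> \<Otimes>\<^sub>M \<nu>) = UNIV" "space \<nu> = UNIV"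
    by (simp_all add: \<mu>_def \<nu>_def space_pair_measure)
  have cdf\<nu>: "cdf \<nu> = G" unfolding \<nu>_def using cdf_B by blast
  have below: "measure \<nu> {..<x} = G x" for x
  proof -
    have "measure \<nu> {x} = 0"
      using \<nu>.isCont_cdf[of x] cont[of x] by (simp add: cdf\<nu>)
    moreover have "measure \<nu> {..x} = measure \<nu> {..<x} + measure \<nu> {x}"
      by (subst \<nu>.finite_measure_Union[symmetric]) (auto intro!: arg_cong[where f="measure \<nu>"])
    ultimately show ?thesis by (simp add: cdf\<nu>[symmetric] cdf_def)
  qed
  have set [measurable]: "{z. snd z < fst z} \<in> sets (\<mu> \<Otimes>\<^sub>M \<nu>)"
  proof -
    have "{z \<in> space (\<mu> \<Otimes>\<^sub>M \<nu>). snd z < fst z} \<in> sets (\<mu> \<Otimes>\<^sub>M \<nu>)" by measurable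
    then show ?thesis by (simp add: sp)
  qed
  have eq: "\<mu> \<Otimes>\<^sub>M \<nu> = distr M (borel \<Otimes>\<^sub>M borel) (\<lambda>\<omega>. (A \<omega>, B \<omega>))"
    using indep unfolding M.indep_var_distribution_eq \<mu>_def \<nu>_def by simp
  have "\<P>(\<omega> in M. B \<omega> < A \<omega>) = measure (\<mu> \<Otimes>\<^sub>M \<nu>) {z. snd z < fst z}"
    unfolding eq
  proof (subst measure_distr)
    show "{z :: real \<times> real. snd z < fst z} \<in> sets (borel \<Otimes>\<^sub>M borel)"
      using set sets_pair_measure_cong[of \<mu> borel \<nu> borel] by (simp add: \<mu>_def \<nu>_def)
  qed (auto intro!: arg_cong[where f="measure M"])
  also have "\<dots> = (\<integral>x. G x \<partial>\<mu>)"
  proof -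
    have G: "0 \<le> G x" "G x \<le> 1" for x
      using below[of x] \<nu>.prob_le_1[of "{..<x}"] measure_nonneg[of \<nu> "{..<x}"] by simp_all
    have "emeasure (\<mu> \<Otimes>\<^sub>M \<nu>) {z. snd z < fst z}
        = (\<integral>\<^sup>+x. emeasure \<nu> (Pair x -` {z. snd z < fst z}) \<partial>\<mu>)"
      by (rule \<nu>.emeasure_pair_measure_alt) (rule set)
    also have "\<dots> = (\<integral>\<^sup>+x. ennreal (G x) \<partial>\<mu>)"
      by (simp add: vimage_def \<nu>.emeasure_eq_measure below flip: lessThan_def)
    also have "\<dots> = ennreal (\<integral>x. G x \<partial>\<mu>)"
      using G by (intro nn_integral_eq_integral \<mu>.integrable_const_bound[where B=1]) auto
    finally show ?thesis
      using G by (simp add: measure_def integral_nonneg_AE)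
  qed
  also have "\<dots> = (\<integral>x. G x \<partial>distr exp_law borel k)"
    unfolding \<mu>_def using distr_exp_law[OF \<open>prob_space M\<close> _ k cdf_A anti pos inv] by simp
  also have "\<dots> = (\<integral>y. G (k y) \<partial>exp_law)"
    by (subst integral_distr) auto
  finally show ?thesis .
qed

section \<open>The logarithm of the normal distribution function\<close>

abbreviation Phi :: "real \<Rightarrow> real" where
  "Phi \<equiv> cdf std_normal_distribution"

interpretation std_normal: real_distribution std_normal_distribution
  by (rule real_dist_normal_dist)

lemma DERIV_Phi: "(Phi has_real_derivative std_normal_density x) (at x)"
proof -
  define a where "a = x - 1"
  have cont: "continuous_on S std_normal_density" for S
    unfolding normal_density_def by (intro continuous_intros) auto
  have eq: "Phi u = Phi a + (LBINT y=a..u. std_normal_density y)" if "a < u" for u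
  proof -
    have "Phi u - Phi a = measure std_normal_distribution {a<..u}"
      by (rule std_normal.cdf_diff_eq[OF that])
    also have "\<dots> = (\<integral>y. indicator {a<..u} y \<partial>std_normal_distribution)"
      by simp
    also have "\<dots> = (LBINT y=a..u. std_normal_density y)"
    proof -
      have "(\<integral>y. indicator {a<..u} y \<partial>std_normal_distribution)
          = (\<integral>y. std_normal_density y * indicator {a<..u} y \<partial>lborel)"
        by (subst integral_density) (simp_all add: normal_density_nonneg)
      also have "\<dots> = (LBINT y:{a<..u}. std_normal_density y)"
        by (simp only: set_lebesgue_integral_def real_scaleR_def mult.commute)
      finally show ?thesis
        using that by (simp only: interval_integral_Ioc[OF less_imp_le])
    qed
    finally show ?thesis by simp
  qed
  have "((\<lambda>u. LBINT y=a..u. std_normal_density y) has_vector_derivative std_normal_density x)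
          (at x within {x-1..x+1})"
    using interval_integral_FTC2[where f=std_normal_density and a="x-1" and b="x+1" and c="x-1" and x=x, OF _ _ cont]
    unfolding a_def by simp
  then have "((\<lambda>u. LBINT y=a..u. std_normal_density y) has_vector_derivative std_normal_density x)
          (at x within {x-1<..<x+1})"
    by (rule has_vector_derivative_within_subset) auto
  then have "((\<lambda>u. LBINT y=a..u. std_normal_density y) has_vector_derivative std_normal_density x) (at x)"
    by (subst (asm) has_vector_derivative_within_open) auto
  then have "((\<lambda>u. LBINT y=a..u. std_normal_density y) has_real_derivative std_normal_density x) (at x)"
    by (simp only: has_real_derivative_iff_has_vector_derivative)
  from DERIV_add[OF DERIV_const[of "Phi a"] this]
  have "((\<lambda>u. Phi a + (LBINT y=a..u. std_normal_density y)) has_real_derivative std_normal_density x) (at x)"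
    by simp
  moreover have "\<forall>\<^sub>F u in nhds x. Phi u = Phi a + (LBINT y=a..u. std_normal_density y)"
    using eventually_nhds_in_open[of "{a<..}" x] 
    by (auto simp: a_def eq[unfolded a_def] elim!: eventually_mono)
  ultimately show ?thesis
    by (subst DERIV_cong_ev[OF refl _ refl])
qed

lemma std_normal_density_pos: "0 < std_normal_density x"
  by (rule normal_density_pos) simp

lemma Phi_strict_mono: "x < y \<Longrightarrow> Phi x < Phi y"
  using DERIV_pos_imp_increasing[of x y Phi] DERIV_Phi std_normal_density_pos by blast

lemma Phi_pos: "0 < Phi x"
  using Phi_strict_mono[of "x - 1" x] std_normal.cdf_nonneg[of "x - 1"] by simp

lemma Phi_less_1: "Phi x < 1"
  using Phi_strict_mono[of x "x + 1"] std_normal.cdf_bounded_prob[of "x + 1"] by simp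

text \<open>
  The logarithmic scale turns the power \<open>\<Phi>\<^sup>n\<close>, the distribution function of a maximum, into a multiple.
\<close>

definition nlogPhi :: "real \<Rightarrow> real" where
  "nlogPhi x = - ln (Phi x)"

lemma exp_nlogPhi: "exp (- nlogPhi x) = Phi x"
  by (simp add: nlogPhi_def Phi_pos)

lemma nlogPhi_pos: "0 < nlogPhi x"
  using Phi_pos[of x] Phi_less_1[of x] by (simp add: nlogPhi_def)

lemma nlogPhi_less_iff: "nlogPhi x < nlogPhi y \<longleftrightarrow> y < x"
  unfolding nlogPhi_def using Phi_pos[of x] Phi_pos[of y] Phi_strict_mono[of x y] Phi_strict_mono[of y x]
  by (cases x y rule: linorder_cases) auto

lemma nlogPhi_le_iff: "nlogPhi x \<le> nlogPhi y \<longleftrightarrow> y \<le> x"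
  using nlogPhi_less_iff[of y x] by (simp add: not_less[symmetric])

lemma DERIV_nlogPhi: "(nlogPhi has_real_derivative - std_normal_density x / Phi x) (at x)"
  unfolding nlogPhi_def
  by (auto intro!: derivative_eq_intros DERIV_Phi simp: Phi_pos)

lemma isCont_nlogPhi: "isCont nlogPhi x"
  by (rule DERIV_isCont[OF DERIV_nlogPhi])

lemma nlogPhi_at_top: "(nlogPhi \<longlongrightarrow> 0) at_top"
proof -
  have "((\<lambda>x. - ln (Phi x)) \<longlongrightarrow> - ln 1) at_top"
    by (intro tendsto_intros std_normal.cdf_lim_at_top_prob) simp
  then show ?thesis by (simp add: nlogPhi_def[abs_def])
qed

lemma nlogPhi_at_bot: "filterlim nlogPhi at_top at_bot"
proof -
  have "filterlim Phi (at_right 0) at_bot"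
    using std_normal.cdf_lim_at_bot Phi_pos
    by (auto simp: filterlim_at less_imp_neq[symmetric])
  then have "filterlim (\<lambda>x. - ln (Phi x)) at_top at_bot"
    unfolding filterlim_uminus_at_bot[symmetric] 
    by (rule filterlim_compose[OF ln_at_0])
  then show ?thesis by (simp add: nlogPhi_def[abs_def])
qed

lemma nlogPhi_surj: assumes "0 < s" shows "\<exists>x. nlogPhi x = s"
proof -
  obtain u where u: "nlogPhi u < s"
    using order_tendstoD(2)[OF nlogPhi_at_top assms] by (auto simp: eventually_at_top_linorder)
  obtain l where l: "s < nlogPhi l"
    using filterlim_at_top_dense[THEN iffD1, OF nlogPhi_at_bot, rule_format, of s]
    by (auto simp: eventually_at_bot_linorder)
  have "l \<le> u" using u l nlogPhi_less_iff[of u l] by simp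
  then show ?thesis
    using IVT2[of nlogPhi u s l] u l isCont_nlogPhi by auto
qed

text \<open>
  The value \<open>0\<close> outside the range of \<open>nlogPhi\<close> is chosen to keep the function measurable.
\<close>

definition nlogPhi_inv :: "real \<Rightarrow> real" where
  "nlogPhi_inv s = (if 0 < s then inv nlogPhi s else 0)"

lemma nlogPhi_nlogPhi_inv: "0 < s \<Longrightarrow> nlogPhi (nlogPhi_inv s) = s"
  using nlogPhi_surj[of s] by (auto simp: nlogPhi_inv_def intro!: f_inv_into_f)

lemma borel_measurable_nlogPhi_inv [measurable]: "nlogPhi_inv \<in> borel_measurable borel"
proof -
  have "(\<lambda>y. if 0 < y then nlogPhi_inv y else 0) \<in> borel_measurable borel"
    by (rule measurable_antimono_inverse[of nlogPhi])
       (auto simp: nlogPhi_le_iff nlogPhi_pos nlogPhi_nlogPhi_inv)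
  also have "(\<lambda>y. if 0 < y then nlogPhi_inv y else 0) = nlogPhi_inv"
    by (auto simp: nlogPhi_inv_def)
  finally show ?thesis .
qed

lemma nlogPhi_inv_le_iff: "0 < s \<Longrightarrow> nlogPhi_inv s \<le> x \<longleftrightarrow> nlogPhi x \<le> s"
  using nlogPhi_le_iff[of x "nlogPhi_inv s"] by (simp add: nlogPhi_nlogPhi_inv)

lemma nlogPhi_inv_at_0: "filterlim nlogPhi_inv at_top (at_right 0)"
  unfolding filterlim_at_top_dense
proof
  fix Z
  have "\<forall>\<^sub>F s in at_right 0. s \<in> {0<..<nlogPhi Z}"
    by (rule eventually_at_right_real) (rule nlogPhi_pos)
  then show "\<forall>\<^sub>F s in at_right 0. Z < nlogPhi_inv s"
    by eventually_elim (use nlogPhi_inv_le_iff in \<open>auto simp: not_le[symmetric]\<close>)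
qed

text \<open>
  Mills' ratio, with \<open>- ln \<Phi>\<close> in the role of the upper tail.  It follows from l'Hopital's rule:
  the quotient of the derivatives is \<open>1 / (\<Phi> x * (1 + 1 / x\<^sup>2))\<close>.
\<close>

lemma nlogPhi_mills: "((\<lambda>x. nlogPhi x / (std_normal_density x / x)) \<longlongrightarrow> 1) at_top"
proof -
  let ?g = "\<lambda>x. std_normal_density x / x" 
  let ?g' = "\<lambda>x. - std_normal_density x * (1 + 1 / x\<^sup>2)"
  let ?f' = "\<lambda>x. - std_normal_density x / Phi x"
  have dphi: "(std_normal_density has_real_derivative - x * std_normal_density x) (at x)" for x
  proof -
    have "((\<lambda>x. c * exp (- x\<^sup>2 / 2)) has_real_derivative - x * (c * exp (- x\<^sup>2 / 2))) (at x)" for c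
      by (auto intro!: derivative_eq_intros)
    from this[of "1 / sqrt (2 * pi)"] show ?thesis by (simp only: std_normal_density_def[symmetric])
  qed
  have dg: "(?g has_real_derivative ?g' x) (at x)" if "0 < x" for x
  proof (rule DERIV_cong[OF DERIV_divide[OF dphi DERIV_ident]])
    show "(- x * std_normal_density x * x - std_normal_density x * 1) / (x * x) = ?g' x"
      using that by (simp add: field_simps power2_eq_square)
  qed (use that in simp)
  have g0: "(?g \<longlongrightarrow> 0) at_top"
    unfolding std_normal_density_def by real_asymp
  have "((\<lambda>x. 1 / (Phi x * (1 + 1 / x\<^sup>2))) \<longlongrightarrow> 1 / (1 * 1)) at_top"
    by (intro tendsto_intros std_normal.cdf_lim_at_top_prob) (real_asymp, simp)
  moreover have "?f' x / ?g' x = 1 / (Phi x * (1 + 1 / x\<^sup>2))" for x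
    using std_normal_density_pos[of x] by (simp add: divide_simps)
  ultimately have lim: "((\<lambda>x. ?f' x / ?g' x) \<longlongrightarrow> 1) at_top" by simp
  have ev: "\<forall>\<^sub>F x in at_top. ?g' x \<noteq> 0"
    using eventually_gt_at_top[of 0] 
  proof eventually_elim
    case (elim x)
    have "1 + 1 / x\<^sup>2 > 0" by (intro add_pos_nonneg) auto
    then show ?case using std_normal_density_pos[of x] by simp
  qed
  \<comment> \<open>L'Hopital's rule for \<open>0 / 0\<close> is applied at \<open>0\<close>, after inverting the argument.\<close>
  let ?R = "at_right (0::real)"
  let ?D = "\<lambda>h x. h (inverse x) * - (inverse x ^ Suc (Suc 0))"
  show ?thesis
    unfolding filterlim_at_top_to_right
  proof (rule lhopital_right_0)
    show "((\<lambda>x. nlogPhi (inverse x)) \<longlongrightarrow> 0) ?R"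
      using nlogPhi_at_top unfolding filterlim_at_top_to_right .
    show "((\<lambda>x. ?g (inverse x)) \<longlongrightarrow> 0) ?R"
      using g0 unfolding filterlim_at_top_to_right .
    show "\<forall>\<^sub>F x in ?R. ?g (inverse x) \<noteq> 0"
      using eventually_at_right_less[of "0::real"]
      by eventually_elim (use std_normal_density_pos in \<open>simp add: less_imp_neq[symmetric]\<close>)
    show "\<forall>\<^sub>F x in ?R. ((\<lambda>x. ?g (inverse x)) has_real_derivative ?D ?g' x) (at x)"
      using eventually_at_right_less[of "0::real"]
    proof eventually_elim
      case (elim x)
      show ?case
        using elim DERIV_chain2[OF dg DERIV_inverse, of x UNIV] by simp
    qed
    show "\<forall>\<^sub>F x in ?R. ((\<lambda>x. nlogPhi (inverse x)) has_real_derivative ?D ?f' x) (at x)"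
      using eventually_at_right_less[of "0::real"]
    proof eventually_elim
      case (elim x)
      show ?case
        using elim DERIV_chain2[OF DERIV_nlogPhi DERIV_inverse, of x UNIV] by simp
    qed
    show "\<forall>\<^sub>F x in ?R. ?D ?g' x \<noteq> 0"
      unfolding eventually_at_right_to_top
      using ev eventually_ge_at_top[where c=1]
      by eventually_elim auto
    show "((\<lambda>x. ?D ?f' x / ?D ?g' x) \<longlongrightarrow> 1) ?R"
      unfolding filterlim_at_right_to_top
      apply (intro filterlim_cong[THEN iffD2, OF refl refl _ lim])
      using eventually_ge_at_top[where c=1]
      by eventually_elim simp
  qed
qed

lemma ln_std_normal_density: "ln (std_normal_density x) = - x\<^sup>2 / 2 - ln (2 * pi) / 2"
proof -
  have "ln (sqrt (2 * pi)) = ln (2 * pi) / 2"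
    by (rule ln_sqrt) simp
  then have "ln (1 / sqrt (2 * pi)) = - ln (2 * pi) / 2"
    by (simp only: ln_div ln_one) simp
  then show ?thesis unfolding std_normal_density_def
    by (subst ln_mult_pos) simp_all
qed

lemma ln_nlogPhi_asymp: "((\<lambda>x. ln (nlogPhi x) + x\<^sup>2 / 2 + ln x) \<longlongrightarrow> - ln (2 * pi) / 2) at_top"
proof -
  have "((\<lambda>x. ln (nlogPhi x / (std_normal_density x / x)) - ln (2 * pi) / 2) \<longlongrightarrow> ln 1 - ln (2 * pi) / 2) at_top"
    by (rule tendsto_diff[OF tendsto_ln[OF nlogPhi_mills] tendsto_const]) simp
  moreover have "\<forall>\<^sub>F x in at_top. ln (nlogPhi x / (std_normal_density x / x)) - ln (2 * pi) / 2 = 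
       ln (nlogPhi x) + x\<^sup>2 / 2 + ln x"
    using eventually_gt_at_top[of 0] 
  proof eventually_elim
    case (elim x)
    show ?case
      using elim nlogPhi_pos[of x] std_normal_density_pos[of x]
      by (simp only: ln_divide_pos divide_pos_pos ln_std_normal_density)
  qed
  ultimately show ?thesis
    by (auto elim: Lim_transform_eventually)
qed

section \<open>Transfer between normal tails and the law of the maxima\<close>

text \<open>
  For small \<open>s\<close> and up to first order: the tail probability of \<open>N(0, \<sigma>\<^sup>2)\<close> at the level where the tail
  probability of \<open>N(0, 1)\<close> equals \<open>s\<close>.
\<close>

definition tail_transfer :: "real \<Rightarrow> real \<Rightarrow> real" where
  "tail_transfer \<sigma> s = nlogPhi (nlogPhi_inv s / \<sigma>)"

lemma tail_transfer_pos: "0 < tail_transfer \<sigma> s"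
  by (simp add: tail_transfer_def nlogPhi_pos)

lemma borel_measurable_nlogPhi [measurable]: "nlogPhi \<in> borel_measurable borel"
  by (intro borel_measurable_continuous_onI continuous_at_imp_continuous_on) (simp add: isCont_nlogPhi)

lemma borel_measurable_tail_transfer [measurable]: "tail_transfer \<sigma> \<in> borel_measurable borel"
  unfolding tail_transfer_def[abs_def] by measurable

lemma tail_transfer_mono:
  assumes "0 < \<sigma>" "0 < s" "s \<le> t" shows "tail_transfer \<sigma> s \<le> tail_transfer \<sigma> t"
proof -
  have "nlogPhi_inv t \<le> nlogPhi_inv s"
    using assms by (simp add: nlogPhi_inv_le_iff nlogPhi_nlogPhi_inv)
  then show ?thesis
    using assms by (simp add: tail_transfer_def nlogPhi_le_iff divide_right_mono)
qed

text \<open>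
  Put \<open>x = nlogPhi_inv s\<close>, so that \<open>ln s = - x\<^sup>2 / 2 - ln x + const + o(1)\<close> by Mills' ratio, and the
  same expansion at \<open>x / \<sigma>\<close> describes \<open>ln (tail_transfer \<sigma> s)\<close>.  The quadratic terms cancel
  because of the weight \<open>1 / \<sigma>\<^sup>2\<close>; the terms in \<open>ln x\<close> that are left over cancel against
  the multiple of \<open>ln (ln (1 / s))\<close>, since the latter is \<open>2 ln x - ln 2 + o(1)\<close>.
\<close>

lemma ln_tail_transfer_asymp:
  assumes "0 < \<sigma>"
  shows "((\<lambda>s. ln (tail_transfer \<sigma> s) - ln s / \<sigma>\<^sup>2 + (1 - 1 / \<sigma>\<^sup>2) / 2 * ln (ln (1 / s)))
           \<longlongrightarrow> ln \<sigma> - (1 - 1 / \<sigma>\<^sup>2) / 2 * ln (4 * pi)) (at_right 0)"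
proof -
  define a b where "a = 1 / \<sigma>\<^sup>2" and "b = (1 - a) / 2"
  define E where "E x = ln (nlogPhi x) + x\<^sup>2 / 2 + ln x" for x
  define e where "e = - ln (2 * pi) / 2"
  \<comment> \<open>\<open>- ln (nlogPhi x) = x\<^sup>2 / 2 * q x\<close>, and \<open>q x\<close> tends to \<open>1\<close>.\<close>
  define q where "q x = 1 + 2 * (ln x / x\<^sup>2) - 2 * (E x * (1 / x\<^sup>2))" for x
  define f where "f x = ln (nlogPhi (x / \<sigma>)) - a * ln (nlogPhi x) + b * ln (- ln (nlogPhi x))" for x
  have E: "(E \<longlongrightarrow> e) at_top"
    unfolding E_def[abs_def] e_def by (rule ln_nlogPhi_asymp)
  have "filterlim (\<lambda>x. x / \<sigma>) at_top at_top"
    using assms by real_asymp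
  from filterlim_compose[OF E this] have E': "((\<lambda>x. E (x / \<sigma>)) \<longlongrightarrow> e) at_top" .
  have l1: "((\<lambda>x::real. ln x / x\<^sup>2) \<longlongrightarrow> 0) at_top" and l2: "((\<lambda>x::real. 1 / x\<^sup>2) \<longlongrightarrow> 0) at_top"
    by real_asymp+
  have q: "(q \<longlongrightarrow> 1) at_top"
    unfolding q_def[abs_def] 
    using tendsto_diff[OF tendsto_add[OF tendsto_const tendsto_mult[OF tendsto_const l1]]
                     tendsto_mult[OF tendsto_const tendsto_mult[OF E l2]], of 1 2 2] by simp
  have lim: "((\<lambda>x. E (x / \<sigma>) - a * E x + b * ln (q x) + (ln \<sigma> - b * ln 2)) \<longlongrightarrow>
        e - a * e + b * ln 1 + (ln \<sigma> - b * ln 2)) at_top"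
    by (intro tendsto_add tendsto_diff tendsto_mult tendsto_const E E' tendsto_ln q) simp
  have val: "e - a * e + b * ln 1 + (ln \<sigma> - b * ln 2) = ln \<sigma> - b * ln (4 * pi)"
  proof -
    have "ln (4 * pi) = ln 2 + ln (2 * pi)"
      using ln_mult_pos[of 2 "2 * pi"] by simp
    then show ?thesis by (simp add: e_def b_def field_simps)
  qed
  have "\<forall>\<^sub>F x in at_top. E (x / \<sigma>) - a * E x + b * ln (q x) + (ln \<sigma> - b * ln 2) = f x"
    using order_tendstoD(1)[OF q zero_less_one] eventually_gt_at_top[of 0]
  proof eventually_elim
    case (elim x)
    have "- ln (nlogPhi x) = x\<^sup>2 / 2 * q x"
      using elim by (simp add: q_def E_def field_simps)
    then have "ln (- ln (nlogPhi x)) = ln (x\<^sup>2 / 2 * q x)"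
      by (rule arg_cong)
    also have "\<dots> = ln (x\<^sup>2 / 2) + ln (q x)"
      using elim by (intro ln_mult_pos) auto
    also have "ln (x\<^sup>2 / 2) = 2 * ln x - ln 2"
      using elim by (simp add: ln_divide_pos ln_realpow)
    finally have ll: "ln (- ln (nlogPhi x)) = 2 * ln x - ln 2 + ln (q x)" .
    have "E (x / \<sigma>) = ln (nlogPhi (x / \<sigma>)) + a * x\<^sup>2 / 2 + ln x - ln \<sigma>"
      using elim assms by (simp add: E_def a_def ln_divide_pos power_divide)
    then show ?case
      unfolding f_def ll by (simp add: E_def b_def field_simps)
  qed
  with lim have "(f \<longlongrightarrow> ln \<sigma> - b * ln (4 * pi)) at_top"
    unfolding val by (rule Lim_transform_eventually)
  from filterlim_compose[OF this nlogPhi_inv_at_0]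
  have "((\<lambda>s. f (nlogPhi_inv s)) \<longlongrightarrow> ln \<sigma> - b * ln (4 * pi)) (at_right 0)" .
  moreover have "\<forall>\<^sub>F s in at_right 0. f (nlogPhi_inv s) =
      ln (tail_transfer \<sigma> s) - ln s / \<sigma>\<^sup>2 + (1 - 1 / \<sigma>\<^sup>2) / 2 * ln (ln (1 / s))"
    using eventually_at_right_less[of "0::real"]
    by eventually_elim (simp add: f_def tail_transfer_def nlogPhi_nlogPhi_inv a_def b_def ln_divide_pos)
  ultimately show ?thesis
    unfolding a_def b_def by (rule Lim_transform_eventually)
qed

text \<open>
  Subtract the expansions at \<open>y / t\<close> and \<open>1 / t\<close>: the iterated logarithm is slowly varying, and
  only the contribution of the power of \<open>s\<close> survives.
\<close>

lemma tail_transfer_regularly_varying: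
  assumes "0 < \<sigma>" "0 < y"
  shows "((\<lambda>t. tail_transfer \<sigma> (y / t) / tail_transfer \<sigma> (1 / t)) \<longlongrightarrow> y powr (1 / \<sigma>\<^sup>2)) at_top"
proof -
  define a b where "a = 1 / \<sigma>\<^sup>2" and "b = (1 - a) / 2"
  define l where "l = ln \<sigma> - b * ln (4 * pi)"
  define R where "R s = ln (tail_transfer \<sigma> s) - a * ln s + b * ln (ln (1 / s))" for s
  have R: "(R \<longlongrightarrow> l) (at_right 0)"
    using ln_tail_transfer_asymp[OF assms(1)] unfolding R_def[abs_def] l_def a_def b_def by simp
  have R': "((\<lambda>t. R (z / t)) \<longlongrightarrow> l) at_top" if "0 < z" for z
  proof (rule filterlim_compose[OF R])
    show "filterlim (\<lambda>t. z / t) (at_right 0) at_top" using that by real_asymp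
  qed
  have "((\<lambda>t. ln (ln (t / y)) - ln (ln t)) \<longlongrightarrow> 0) at_top"
    using assms by real_asymp
  then have "((\<lambda>t. R (y / t) - R (1 / t) + a * ln y - b * (ln (ln (t / y)) - ln (ln t))) \<longlongrightarrow>
        l - l + a * ln y - b * 0) at_top"
    by (intro tendsto_intros R' assms) simp_all
  then have "((\<lambda>t. exp (R (y / t) - R (1 / t) + a * ln y - b * (ln (ln (t / y)) - ln (ln t)))) \<longlongrightarrow>
        exp (a * ln y)) at_top"
    by (intro tendsto_exp) simp
  moreover have "\<forall>\<^sub>F t in at_top. exp (R (y / t) - R (1 / t) + a * ln y - b * (ln (ln (t / y)) - ln (ln t))) =
      tail_transfer \<sigma> (y / t) / tail_transfer \<sigma> (1 / t)"
    using eventually_gt_at_top[of 0]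
  proof eventually_elim
    case (elim t)
    have "R (y / t) - R (1 / t) + a * ln y - b * (ln (ln (t / y)) - ln (ln t)) =
        ln (tail_transfer \<sigma> (y / t)) - ln (tail_transfer \<sigma> (1 / t))"
      using elim assms by (simp add: R_def ln_divide_pos algebra_simps)
    then show ?case by (simp add: exp_diff tail_transfer_pos)
  qed
  moreover have "exp (a * ln y) = y powr (1 / \<sigma>\<^sup>2)"
    using assms by (simp add: powr_def a_def)
  ultimately show ?thesis
    by (auto elim: Lim_transform_eventually)
qed

lemma cdf_normal:
  assumes "prob_space M" "0 < \<sigma>" and D: "distributed M lborel X (normal_density 0 \<sigma>)"
  shows "cdf (distr M borel X) x = exp (- nlogPhi (x / \<sigma>))"
proof -
  interpret prob_space M by fact
  have [measurable]: "X \<in> borel_measurable M"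
    using distributed_measurable[OF D] by simp
  have "distributed M lborel (\<lambda>\<omega>. (X \<omega> - 0) / \<sigma>) std_normal_density"
    using D normal_standard_normal_convert[OF \<open>0 < \<sigma>\<close>] by simp
  then have "distr M lborel (\<lambda>\<omega>. X \<omega> / \<sigma>) = std_normal_distribution"
    by (simp add: distributed_distr_eq_density)
  then have "Phi (x / \<sigma>) = measure (distr M lborel (\<lambda>\<omega>. X \<omega> / \<sigma>)) {..x / \<sigma>}"
    by (simp add: cdf_def)
  also have "\<dots> = cdf (distr M borel X) x"
    unfolding cdf_def using \<open>0 < \<sigma>\<close>
    by (subst (1 2) measure_distr) (auto intro!: arg_cong[where f=prob] simp: field_simps)
  finally show ?thesis by (simp add: exp_nlogPhi)
qed

lemma cdf_Max_indep:
  fixes X :: "'i \<Rightarrow> 'a \<Rightarrow> real"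
  assumes "prob_space M" "prob_space.indep_vars M (\<lambda>_. borel) X I" and I: "finite I" "I \<noteq> {}"
    and cdf: "\<And>i. i \<in> I \<Longrightarrow> cdf (distr M borel (X i)) x = exp (- h)"
  shows "cdf (distr M borel (\<lambda>\<omega>. MAX i\<in>I. X i \<omega>)) x = exp (- (real (card I) * h))"
proof -
  interpret prob_space M by fact
  have rv: "X i \<in> borel_measurable M" if "i \<in> I" for i
    using assms(2) that by (auto simp: indep_vars_def)
  have meas: "(\<lambda>\<omega>. MAX i\<in>I. X i \<omega>) \<in> borel_measurable M"
    using I rv by (intro borel_measurable_Max) auto
  have eq: "(\<lambda>\<omega>. MAX i\<in>I. X i \<omega>) -` {..x} \<inter> space M = (\<Inter>i\<in>I. X i -` {..x} \<inter> space M)"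
  proof (rule set_eqI)
    fix \<omega>
    have "(MAX i\<in>I. X i \<omega>) \<le> x \<longleftrightarrow> (\<forall>i\<in>I. X i \<omega> \<le> x)"
      using I by (subst Max_le_iff) auto
    then show "\<omega> \<in> (\<lambda>\<omega>. MAX i\<in>I. X i \<omega>) -` {..x} \<inter> space M \<longleftrightarrow> \<omega> \<in> (\<Inter>i\<in>I. X i -` {..x} \<inter> space M)"
      using I(2) by auto
  qed
  have "cdf (distr M borel (\<lambda>\<omega>. MAX i\<in>I. X i \<omega>)) x = prob (\<Inter>i\<in>I. X i -` {..x} \<inter> space M)"
  proof -
    have "measure (distr M borel (\<lambda>\<omega>. MAX i\<in>I. X i \<omega>)) {..x}
        = prob ((\<lambda>\<omega>. MAX i\<in>I. X i \<omega>) -` {..x} \<inter> space M)"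
      by (rule measure_distr[OF meas atMost_borel])
    then show ?thesis unfolding cdf_def eq .
  qed
  also have "\<dots> = (\<Prod>i\<in>I. prob (X i -` {..x} \<inter> space M))"
    using I by (intro indep_varsD[OF assms(2)]) auto
  also have "\<dots> = (\<Prod>i\<in>I. exp (- h))"
    using cdf rv by (intro prod.cong) (auto simp: cdf_def measure_distr)
  finally show ?thesis by (simp add: exp_of_nat_mult[symmetric])
qed

lemma prob_max_greater:
  fixes X :: "nat \<Rightarrow> 'a \<Rightarrow> real"
  assumes "prob_space M" "0 < \<sigma>" and I: "finite I" "I \<noteq> {}" and J: "finite J" "J \<noteq> {}" "I \<inter> J = {}"
    and X1: "\<And>i. i \<in> I \<Longrightarrow> distributed M lborel (X i) (normal_density 0 1)"
    and X2: "\<And>i. i \<in> J \<Longrightarrow> distributed M lborel (X i) (normal_density 0 \<sigma>)"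
    and ind: "prob_space.indep_vars M (\<lambda>_. borel) X (I \<union> J)"
  shows "\<P>(\<omega> in M. (MAX i\<in>I. X i \<omega>) > (MAX i\<in>J. X i \<omega>)) =
    (\<integral>y. exp (- (real (card J) * tail_transfer \<sigma> (y / real (card I)))) \<partial>exp_law)"
proof -
  interpret prob_space M by fact
  define n where "n = real (card I)"
  have n: "0 < n" using I by (auto simp: n_def card_gt_0_iff)
  have "indep_var borel ((\<lambda>f. Max (f ` I)) \<circ> (\<lambda>\<omega>. restrict (\<lambda>i. X i \<omega>) I))
                  borel ((\<lambda>f. Max (f ` J)) \<circ> (\<lambda>\<omega>. restrict (\<lambda>i. X i \<omega>) J))"
    using I J by (intro indep_var_compose[OF indep_var_restrict[OF ind]] borel_measurable_Max) auto
  then have MM: "indep_var borel (\<lambda>\<omega>. MAX i\<in>I. X i \<omega>) borel (\<lambda>\<omega>. MAX i\<in>J. X i \<omega>)"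
    by (simp add: comp_def)
  have "\<P>(\<omega> in M. (MAX i\<in>J. X i \<omega>) < (MAX i\<in>I. X i \<omega>)) =
      (\<integral>y. exp (- (real (card J) * nlogPhi (nlogPhi_inv (y / n) / \<sigma>))) \<partial>exp_law)"
  proof (rule prob_less_eq_integral_exp_law[OF _ MM, where K="\<lambda>x. n * nlogPhi x"
        and k="\<lambda>y. nlogPhi_inv (y / n)" and G="\<lambda>x. exp (- (real (card J) * nlogPhi (x / \<sigma>)))"])
    show "prob_space M" by fact
    show "(\<lambda>y. nlogPhi_inv (y / n)) \<in> borel_measurable borel" by measurable
    show "cdf (distr M borel (\<lambda>\<omega>. MAX i\<in>I. X i \<omega>)) x = exp (- (n * nlogPhi x))" for x
      unfolding n_def using cdf_normal[OF \<open>prob_space M\<close> zero_less_one X1]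
      by (intro cdf_Max_indep I indep_vars_subset[OF ind] \<open>prob_space M\<close>) auto
    show "cdf (distr M borel (\<lambda>\<omega>. MAX i\<in>J. X i \<omega>)) x = exp (- (real (card J) * nlogPhi (x / \<sigma>)))" for x
      using cdf_normal[OF \<open>prob_space M\<close> \<open>0 < \<sigma>\<close> X2]
      by (intro cdf_Max_indep J indep_vars_subset[OF ind] \<open>prob_space M\<close>) auto
    show "isCont (\<lambda>x. exp (- (real (card J) * nlogPhi (x / \<sigma>)))) x" for x
    proof -
      have "isCont (\<lambda>x. nlogPhi (x / \<sigma>)) x"
        by (rule isCont_o2[where f="\<lambda>x. x / \<sigma>"])
           (use \<open>0 < \<sigma>\<close> in \<open>auto intro!: continuous_intros isCont_nlogPhi\<close>)
      then show ?thesis by (intro continuous_intros)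
    qed
  qed (use n in \<open>auto simp: nlogPhi_le_iff nlogPhi_pos nlogPhi_nlogPhi_inv\<close>)
  then show ?thesis by (simp add: tail_transfer_def n_def)
qed

section \<open>The limit of the winning probability\<close>

text \<open>
  The limiting probability that the first sample wins if, in the limit, the second one competes
  with intensity \<open>c\<close>.
\<close>

definition race_limit :: "real \<Rightarrow> real \<Rightarrow> real" where
  "race_limit a c = (\<integral>y. exp (- (c * y powr a)) \<partial>exp_law)"

lemma race_limit_eq: "race_limit a c = (LBINT y:{0..}. exp (- y - c * y powr a))"
proof -
  have "exp (- y) * exp (- (c * y powr a)) = exp (- y - c * y powr a)" for y
    by (simp add: exp_add[symmetric])
  then show ?thesis
    unfolding race_limit_def by (subst integral_exp_law) simp_all
qed

lemma integrable_exp_law_exp_minus: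
  assumes [measurable]: "h \<in> borel_measurable borel" and nn: "\<And>y. 0 < y \<Longrightarrow> 0 \<le> h y"
  shows "integrable exp_law (\<lambda>y. exp (- h y) :: real)"
proof (rule exp_law.integrable_const_bound[where B=1])
  show "AE y in exp_law. norm (exp (- h y)) \<le> 1"
    using AE_exp_law_pos by eventually_elim (simp add: nn)
qed measurable

lemma race_limit_strict_antimono:
  assumes "0 \<le> c" "c < d"
  shows "race_limit a d < race_limit a c"
  unfolding race_limit_def
proof (rule exp_law.integral_less_AE_space)
  show "AE y in exp_law. exp (- (d * y powr a)) < exp (- (c * y powr a))"
    using AE_exp_law_pos by eventually_elim (use assms in simp)
  show "emeasure exp_law (space exp_law) \<noteq> 0"
    using exp_law.emeasure_space_1 by simp
qed (use assms in \<open>auto intro!: integrable_exp_law_exp_minus\<close>)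

lemma race_limit_0 [simp]: "race_limit a 0 = 1"
  using exp_law.prob_space by (simp add: race_limit_def)

lemma race_limit_nonneg: "0 \<le> race_limit a c"
  by (simp add: race_limit_def)

lemma race_limit_bounds:
  assumes "0 < c" shows "0 < race_limit a c" "race_limit a c < 1"
  using race_limit_strict_antimono[of c "c + 1" a] race_limit_strict_antimono[of 0 c a]
    race_limit_nonneg[of a "c + 1"] assms by simp_all

lemma race_limit_tendsto_0: "(\<lambda>n. race_limit a (real n)) \<longlonglongrightarrow> 0"
proof -
  have "(\<lambda>n. race_limit a (real n)) \<longlonglongrightarrow> (\<integral>y. 0 \<partial>exp_law)"
    unfolding race_limit_def
  proof (rule integral_exp_law_tendsto)
    fix y :: real assume "0 < y"
    then have "0 < y powr a" by simp
    then show "(\<lambda>n. exp (- (real n * y powr a))) \<longlonglongrightarrow> 0" by real_asymp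
  qed auto
  then show ?thesis by simp
qed

lemma continuous_on_race_limit: "continuous_on {0..} (race_limit a)"
proof (rule continuous_on_sequentiallyI)
  fix u c assume u: "\<forall>n. u n \<in> {0..}" "u \<longlonglongrightarrow> (c::real)"
  show "(\<lambda>n. race_limit a (u n)) \<longlonglongrightarrow> race_limit a c"
    unfolding race_limit_def
  proof (rule integral_exp_law_tendsto)
    fix y :: real
    show "(\<lambda>n. exp (- (u n * y powr a))) \<longlonglongrightarrow> exp (- (c * y powr a))"
      by (intro tendsto_intros u)
  qed (use u in auto)
qed

lemma race_limit_surj:
  assumes "0 < L" "L < 1" shows "\<exists>c>0. race_limit a c = L"
proof -
  obtain n where n: "race_limit a (real n) < L"
    using order_tendstoD(2)[OF race_limit_tendsto_0 assms(1)] by (auto simp: eventually_sequentially)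
  have "\<exists>c\<ge>0. c \<le> real n \<and> race_limit a c = L"
    using n assms
    by (intro IVT2') (auto intro: continuous_on_subset[OF continuous_on_race_limit])
  then obtain c where c: "0 \<le> c" "race_limit a c = L" by blast
  then have "c \<noteq> 0" using assms by auto
  then show ?thesis using c by (intro exI[of _ c]) auto
qed

text \<open>
  The probability that the first maximum exceeds the second, in the form given by
  \<open>prob_max_greater\<close>.
\<close>

definition race_prob :: "real \<Rightarrow> nat \<Rightarrow> nat \<Rightarrow> real" where
  "race_prob \<sigma> n1 n2 = (\<integral>y. exp (- (real n2 * tail_transfer \<sigma> (y / real n1))) \<partial>exp_law)"

text \<open>
  Up to first order: the expected number of points of the second sample above the level that the
  first sample exceeds once on average.
\<close>

definition race_rate :: "real \<Rightarrow> nat \<Rightarrow> nat \<Rightarrow> real" where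
  "race_rate \<sigma> n1 n2 = real n2 * tail_transfer \<sigma> (1 / real n1)"

lemma race_rate_nonneg: "0 \<le> race_rate \<sigma> n1 n2"
  using tail_transfer_pos[of \<sigma> "1 / real n1"] by (simp add: race_rate_def)

text \<open>
  The rate \<open>c m\<close> is kept independent of \<open>n1 m\<close>, so that also constant rates can be inserted for
  comparison.
\<close>

lemma race_prob_tendsto_scaled:
  assumes "0 < \<sigma>" and n1: "filterlim (\<lambda>m. real (n1 m)) at_top sequentially"
    and c: "\<And>m. 0 \<le> c m" "c \<longlonglongrightarrow> c0"
  shows "(\<lambda>m. \<integral>y. exp (- (c m * (tail_transfer \<sigma> (y / real (n1 m)) / tail_transfer \<sigma> (1 / real (n1 m))))) \<partial>exp_law)
     \<longlonglongrightarrow> race_limit (1 / \<sigma>\<^sup>2) c0"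
  unfolding race_limit_def
proof (rule integral_exp_law_tendsto)
  fix y :: real assume "0 < y"
  from filterlim_compose[OF tail_transfer_regularly_varying[OF assms(1) this] n1]
  show "(\<lambda>m. exp (- (c m * (tail_transfer \<sigma> (y / real (n1 m)) / tail_transfer \<sigma> (1 / real (n1 m))))))
      \<longlonglongrightarrow> exp (- (c0 * y powr (1 / \<sigma>\<^sup>2)))"
    by (intro tendsto_intros c)
qed (use c in \<open>auto simp: less_imp_le[OF tail_transfer_pos]\<close>)

lemma race_prob_eq_scaled:
  "race_prob \<sigma> n1 n2 =
    (\<integral>y. exp (- (race_rate \<sigma> n1 n2 * (tail_transfer \<sigma> (y / real n1) / tail_transfer \<sigma> (1 / real n1)))) \<partial>exp_law)"
  using tail_transfer_pos[of \<sigma> "1 / real n1"] by (simp add: race_prob_def race_rate_def)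

lemma race_prob_tendsto:
  assumes "0 < \<sigma>" "filterlim (\<lambda>m. real (n1 m)) at_top sequentially"
    and "(\<lambda>m. race_rate \<sigma> (n1 m) (n2 m)) \<longlonglongrightarrow> c"
  shows "(\<lambda>m. race_prob \<sigma> (n1 m) (n2 m)) \<longlonglongrightarrow> race_limit (1 / \<sigma>\<^sup>2) c"
  unfolding race_prob_eq_scaled
  by (rule race_prob_tendsto_scaled[OF assms(1,2) race_rate_nonneg assms(3)])

text \<open>
  At a fixed rate \<open>d\<close> the scaled integral tends to \<open>race_limit a d\<close> and is decreasing in \<open>d\<close>.
  If \<open>d\<close> lies below the solution \<open>c\<close> of \<open>race_limit a c = L\<close>, that limit exceeds \<open>L\<close>, so the
  actual rates must eventually exceed \<open>d\<close>; similarly from above.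
\<close>

lemma race_rate_tendsto:
  assumes "0 < \<sigma>" and n1: "filterlim (\<lambda>m. real (n1 m)) at_top sequentially"
    and lim: "(\<lambda>m. race_prob \<sigma> (n1 m) (n2 m)) \<longlonglongrightarrow> L" and L: "0 < L" "L < 1"
  shows "\<exists>c>0. (\<lambda>m. race_rate \<sigma> (n1 m) (n2 m)) \<longlonglongrightarrow> c"
proof -
  define a where "a = 1 / \<sigma>\<^sup>2"
  obtain c where c: "0 < c" "race_limit a c = L" using race_limit_surj[OF L] by blast
  define J where "J m d = (\<integral>y. exp (- (d * (tail_transfer \<sigma> (y / real (n1 m)) / tail_transfer \<sigma> (1 / real (n1 m))))) \<partial>exp_law)"
    for m d
  have J: "(\<lambda>m. J m d) \<longlonglongrightarrow> race_limit a d" if "0 \<le> d" for d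
    unfolding J_def a_def by (rule race_prob_tendsto_scaled[OF assms(1) n1]) (use that in auto)
  have J_anti: "J m d' \<le> J m d" if "0 \<le> d" "d \<le> d'" for m d d'
    unfolding J_def using that
    by (intro integral_mono integrable_exp_law_exp_minus)
       (auto intro!: mult_right_mono divide_right_mono simp: less_imp_le[OF tail_transfer_pos])
  have p: "race_prob \<sigma> (n1 m) (n2 m) = J m (race_rate \<sigma> (n1 m) (n2 m))" for m
    unfolding J_def by (rule race_prob_eq_scaled)
  have "(\<lambda>m. race_rate \<sigma> (n1 m) (n2 m)) \<longlonglongrightarrow> c"
  proof (rule order_tendstoI)
    fix d assume "d < c"
    \<comment> \<open>A rate at most \<open>d\<close> would give a probability of at least \<open>J m d\<close>, which stays above \<open>L\<close>.\<close>
    show "\<forall>\<^sub>F m in sequentially. d < race_rate \<sigma> (n1 m) (n2 m)"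
    proof (cases "0 \<le> d")
      case True
      then have "L < race_limit a d"
        using race_limit_strict_antimono[of d c a] \<open>d < c\<close> c by simp
      then obtain t where t: "L < t" "t < race_limit a d" using dense by blast
      show ?thesis
        using order_tendstoD(2)[OF lim t(1)] order_tendstoD(1)[OF J[OF True] t(2)]
      proof eventually_elim
        case (elim m)
        then show ?case
          using J_anti[OF race_rate_nonneg, of \<sigma> "n1 m" "n2 m" d m] by (auto simp: p not_le[symmetric])
      qed
    next
      case False
      then show ?thesis using race_rate_nonneg[of \<sigma>] by (auto intro!: always_eventually intro: less_le_trans simp: not_le)
    qed
  next
    fix d assume "c < d"
    then have "race_limit a d < L"
      using race_limit_strict_antimono[of c d a] c by simp
    then obtain t where t: "race_limit a d < t" "t < L" using dense by blast
    have d: "0 \<le> d" using c \<open>c < d\<close> by simp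
    show "\<forall>\<^sub>F m in sequentially. race_rate \<sigma> (n1 m) (n2 m) < d"
      using order_tendstoD(1)[OF lim t(2)] order_tendstoD(2)[OF J[OF d] t(1)]
    proof eventually_elim
      case (elim m)
      then show ?case
        using J_anti[OF d, of "race_rate \<sigma> (n1 m) (n2 m)" m] by (auto simp: p not_le[symmetric])
    qed
  qed
  then show ?thesis using c by blast
qed

text \<open>
  As long as \<open>n1 m\<close> stays below a bound, \<open>n2 m\<close> is large, and the probability is at most the one
  with \<open>n1 m\<close> replaced by that bound, which vanishes as \<open>n2 m\<close> grows.
\<close>

lemma first_sample_at_top:
  assumes "0 < \<sigma>" and n1: "\<forall>\<^sub>F m in sequentially. 0 < n1 m"
    and sum: "filterlim (\<lambda>m. n1 m + n2 m) at_top sequentially"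
    and lim: "(\<lambda>m. race_prob \<sigma> (n1 m) (n2 m)) \<longlonglongrightarrow> L" and L: "0 < L"
  shows "filterlim (\<lambda>m. n1 m) at_top sequentially"
  unfolding filterlim_at_top
proof
  fix K :: nat
  define Q where "Q N = (\<integral>y. exp (- (real N * tail_transfer \<sigma> (y / real (Suc K)))) \<partial>exp_law)" for N :: nat
  have "Q \<longlonglongrightarrow> (\<integral>y. 0 \<partial>exp_law)"
    unfolding Q_def[abs_def]
  proof (rule integral_exp_law_tendsto)
    fix y :: real
    have "0 < tail_transfer \<sigma> (y / real (Suc K))" by (rule tail_transfer_pos)
    then show "(\<lambda>N. exp (- (real N * tail_transfer \<sigma> (y / real (Suc K))))) \<longlonglongrightarrow> 0" by real_asymp
  qed (auto simp: less_imp_le[OF tail_transfer_pos])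
  then have "Q \<longlonglongrightarrow> 0" by simp
  then obtain N where N: "Q N < L / 2"
    using order_tendstoD(2)[of Q 0 sequentially "L / 2"] L by (auto simp: eventually_sequentially)
  have "L / 2 < L" using L by simp
  from n1 sum[unfolded filterlim_at_top, rule_format, of "K + N"] order_tendstoD(1)[OF lim this]
  show "\<forall>\<^sub>F m in sequentially. K \<le> n1 m"
  proof eventually_elim
    case (elim m)
    show ?case
    proof (rule ccontr)
      assume "\<not> K \<le> n1 m"
      then have K: "n1 m \<le> Suc K" and "N \<le> n2 m" using elim by auto
      have "race_prob \<sigma> (n1 m) (n2 m) \<le> Q N"
        unfolding race_prob_def Q_def
      proof (rule integral_mono_AE)
        show "AE y in exp_law. exp (- (real (n2 m) * tail_transfer \<sigma> (y / real (n1 m))))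
            \<le> exp (- (real N * tail_transfer \<sigma> (y / real (Suc K))))"
          using AE_exp_law_pos
        proof eventually_elim
          case (elim y)
          have "tail_transfer \<sigma> (y / real (Suc K)) \<le> tail_transfer \<sigma> (y / real (n1 m))"
            using K \<open>0 < n1 m\<close> elim \<open>0 < \<sigma>\<close>
            by (intro tail_transfer_mono divide_left_mono) auto
          then have "real N * tail_transfer \<sigma> (y / real (Suc K)) \<le> real (n2 m) * tail_transfer \<sigma> (y / real (n1 m))"
            using \<open>N \<le> n2 m\<close> by (intro mult_mono) (auto simp: less_imp_le[OF tail_transfer_pos])
          then show ?case by simp
        qed
      qed (auto intro!: integrable_exp_law_exp_minus mult_nonneg_nonneg simp: less_imp_le[OF tail_transfer_pos])
      then show False using N elim by simp
    qed
  qed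
qed

section \<open>The growth condition in logarithmic form\<close>

text \<open>
  The hypothesis makes \<open>a x\<close> the leading term of \<open>y\<close>, hence \<open>y / x\<close> tends to \<open>a\<close>.  It is used with
  the logarithms of the sample sizes, in either order.
\<close>

lemma log_balance:
  fixes x y :: "nat \<Rightarrow> real"
  assumes x: "filterlim x at_top sequentially" and a: "0 < a"
    and lim: "(\<lambda>m. y m - a * x m - b * ln (x m)) \<longlonglongrightarrow> k"
  shows "filterlim y at_top sequentially" "(\<lambda>m. ln (y m) - ln (x m)) \<longlonglongrightarrow> ln a"
proof -
  have l1: "(\<lambda>m. ln (x m) / x m) \<longlonglongrightarrow> 0" and l2: "(\<lambda>m. 1 / x m) \<longlonglongrightarrow> 0"
    by (rule filterlim_compose[OF _ x], real_asymp)+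
  have "(\<lambda>m. (y m - a * x m - b * ln (x m)) * (1 / x m) + a + b * (ln (x m) / x m)) \<longlonglongrightarrow> k * 0 + a + b * 0"
    by (intro tendsto_intros lim l1 l2)
  moreover have "\<forall>\<^sub>F m in sequentially.
      (y m - a * x m - b * ln (x m)) * (1 / x m) + a + b * (ln (x m) / x m) = y m / x m"
    using filterlim_at_top_dense[THEN iffD1, OF x, rule_format, of 0]
    by eventually_elim (simp add: field_simps)
  ultimately have q: "(\<lambda>m. y m / x m) \<longlonglongrightarrow> a"
    by (auto elim: Lim_transform_eventually)
  have pos: "\<forall>\<^sub>F m in sequentially. 0 < x m \<and> 0 < y m / x m"
    using filterlim_at_top_dense[THEN iffD1, OF x, rule_format, of 0] order_tendstoD(1)[OF q a]
    by eventually_elim simp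
  have "filterlim (\<lambda>m. y m / x m * x m) at_top sequentially"
    by (rule filterlim_tendsto_pos_mult_at_top[OF q a x])
  moreover have "\<forall>\<^sub>F m in sequentially. y m / x m * x m = y m"
    using pos by eventually_elim simp
  ultimately show "filterlim y at_top sequentially"
    by (simp cong: filterlim_cong)
  have "(\<lambda>m. ln (y m / x m)) \<longlonglongrightarrow> ln a"
    using a by (intro tendsto_ln q) simp
  moreover have "\<forall>\<^sub>F m in sequentially. ln (y m / x m) = ln (y m) - ln (x m)"
    using pos by eventually_elim (auto simp: ln_divide_pos zero_less_divide_iff)
  ultimately show "(\<lambda>m. ln (y m) - ln (x m)) \<longlonglongrightarrow> ln a"
    by (auto elim: Lim_transform_eventually)
qed

lemma critical_growth_iff_ln:
  assumes "0 < C" and n1: "\<forall>\<^sub>F m in sequentially. 0 < n1 m" and n2: "\<forall>\<^sub>F m in sequentially. 2 \<le> n2 m"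
  shows "critical_growth \<sigma> C n1 n2 \<longleftrightarrow>
    (\<lambda>m. ln (real (n1 m)) - \<sigma>\<^sup>2 * ln (real (n2 m)) + (\<sigma>\<^sup>2 - 1) / 2 * ln (ln (real (n2 m)))) \<longlonglongrightarrow> ln C"
    (is "_ \<longleftrightarrow> ?e \<longlonglongrightarrow> _")
proof -
  define r where "r m = C * real (n2 m) powr (\<sigma>\<^sup>2) * ln (real (n2 m)) powr (- ((\<sigma>\<^sup>2 - 1) / 2))" for m
  have ev: "\<forall>\<^sub>F m in sequentially. 0 < r m \<and> 0 < real (n1 m) / r m \<and> ln (real (n1 m) / r m) = ?e m - ln C"
    using n1 n2
  proof eventually_elim
    case (elim m)
    have l: "0 < ln (real (n2 m))" using elim by (intro ln_gt_zero) simp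
    have r: "0 < r m" using elim l assms(1) by (simp add: r_def)
    have "ln (r m) = ln C + \<sigma>\<^sup>2 * ln (real (n2 m)) - (\<sigma>\<^sup>2 - 1) / 2 * ln (ln (real (n2 m)))"
      unfolding r_def using elim l assms(1) by (simp add: ln_mult_pos ln_powr)
    then show ?case using r elim by (simp add: ln_divide_pos)
  qed
  have "critical_growth \<sigma> C n1 n2 \<longleftrightarrow> (\<lambda>m. real (n1 m) / r m) \<longlonglongrightarrow> 1"
  proof
    assume "critical_growth \<sigma> C n1 n2"
    then have "asymp_equiv (\<lambda>m. real (n1 m)) sequentially r"
      by (simp add: critical_growth_def r_def[abs_def])
    then show "(\<lambda>m. real (n1 m) / r m) \<longlonglongrightarrow> 1"
      by (rule asymp_equivD_strong) (use ev in \<open>auto elim!: eventually_mono\<close>)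
  next
    assume "(\<lambda>m. real (n1 m) / r m) \<longlonglongrightarrow> 1"
    then have "asymp_equiv (\<lambda>m. real (n1 m)) sequentially r"
      by (rule asymp_equivI')
    then show "critical_growth \<sigma> C n1 n2"
      using n2 by (simp add: critical_growth_def r_def[abs_def])
  qed
  also have "\<dots> \<longleftrightarrow> (\<lambda>m. ln (real (n1 m) / r m)) \<longlonglongrightarrow> 0"
  proof
    assume "(\<lambda>m. real (n1 m) / r m) \<longlonglongrightarrow> 1"
    from tendsto_ln[OF this] show "(\<lambda>m. ln (real (n1 m) / r m)) \<longlonglongrightarrow> 0" by simp
  next
    assume "(\<lambda>m. ln (real (n1 m) / r m)) \<longlonglongrightarrow> 0"
    from tendsto_exp[OF this] have "(\<lambda>m. exp (ln (real (n1 m) / r m))) \<longlonglongrightarrow> 1" by simp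
    then show "(\<lambda>m. real (n1 m) / r m) \<longlonglongrightarrow> 1"
      by (rule Lim_transform_eventually) (use ev in \<open>auto elim!: eventually_mono\<close>)
  qed
  also have "\<dots> \<longleftrightarrow> (\<lambda>m. ?e m - ln C) \<longlonglongrightarrow> 0"
    by (rule tendsto_cong) (use ev in \<open>auto elim!: eventually_mono\<close>)
  also have "\<dots> \<longleftrightarrow> ?e \<longlonglongrightarrow> ln C"
    by (simp add: LIM_zero_iff)
  finally show ?thesis .
qed

text \<open>
  If \<open>n2 m\<close> takes a value between \<open>2\<close> and \<open>K\<close>, the growth condition bounds \<open>n1 m\<close> too, which
  the divergence of the sum excludes for large \<open>m\<close>.
\<close>

lemma critical_growth_second_sample_at_top:
  assumes "0 < C" and cg: "critical_growth \<sigma> C n1 n2"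
    and sum: "filterlim (\<lambda>m. n1 m + n2 m) at_top sequentially"
  shows "filterlim n2 at_top sequentially"
  unfolding filterlim_at_top
proof
  fix K :: nat
  define R where "R k = C * real k powr (\<sigma>\<^sup>2) * ln (real k) powr (- ((\<sigma>\<^sup>2 - 1) / 2))" for k :: nat
  have R: "0 < R k" if "2 \<le> k" for k
    using that assms(1) by (simp add: R_def)
  \<comment> \<open>This bounds \<open>n1 m\<close> as soon as \<open>n1 m < 2 * R (n2 m)\<close> and \<open>2 \<le> n2 m \<le> K\<close>.\<close>
  define B where "B = nat \<lceil>\<Sum>k=2..K. 2 * R k\<rceil>"
  have n2: "\<forall>\<^sub>F m in sequentially. 2 \<le> n2 m"
    and "asymp_equiv (\<lambda>m. real (n1 m)) sequentially (\<lambda>m. R (n2 m))"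
    using cg by (simp_all add: critical_growth_def R_def[abs_def])
  from this(2) have "(\<lambda>m. real (n1 m) / R (n2 m)) \<longlonglongrightarrow> 1"
    by (rule asymp_equivD_strong) (use n2 R in \<open>force elim!: eventually_mono\<close>)
  then have "\<forall>\<^sub>F m in sequentially. real (n1 m) / R (n2 m) < 2"
    by (rule order_tendstoD) simp
  with n2 sum[unfolded filterlim_at_top, rule_format, of "B + K"]
  show "\<forall>\<^sub>F m in sequentially. K \<le> n2 m"
  proof eventually_elim
    case (elim m)
    show ?case
    proof (rule ccontr)
      assume K: "\<not> K \<le> n2 m"
      have "real (n1 m) < 2 * R (n2 m)"
        using elim R[of "n2 m"] by (simp add: field_simps)
      also have "\<dots> \<le> (\<Sum>k=2..K. 2 * R k)"
        using K elim R by (intro member_le_sum) (auto intro: less_imp_le)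
      also have "\<dots> \<le> real B" unfolding B_def by linarith
      finally show False using K elim by simp
    qed
  qed
qed

section \<open>Rates, growth and the Gumbel race\<close>

lemma ln_tail_transfer_inverse_nat:
  assumes "0 < \<sigma>" and n1: "filterlim (\<lambda>m. real (n1 m)) at_top sequentially"
  shows "(\<lambda>m. ln (tail_transfer \<sigma> (1 / real (n1 m))) + 1 / \<sigma>\<^sup>2 * ln (real (n1 m))
      + (1 - 1 / \<sigma>\<^sup>2) / 2 * ln (ln (real (n1 m)))) \<longlonglongrightarrow> ln \<sigma> - (1 - 1 / \<sigma>\<^sup>2) / 2 * ln (4 * pi)"
proof -
  have "filterlim (\<lambda>t::real. 1 / t) (at_right 0) at_top" by real_asymp
  from filterlim_compose[OF ln_tail_transfer_asymp[OF assms(1)] filterlim_compose[OF this n1]]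
  show ?thesis
    by (rule Lim_transform_eventually)
       (use filterlim_at_top_dense[THEN iffD1, OF n1, rule_format, of 0] in
         \<open>auto elim!: eventually_mono simp: ln_divide_pos\<close>)
qed

text \<open>
  With \<open>u\<close>, \<open>v\<close> the logarithms of the sample sizes and \<open>t\<close> the convergent expansion of
  \<open>ln (tail_transfer \<sigma> (1 / n1))\<close>, the logarithm of the rate is
  \<open>t - a (u - \<sigma>\<^sup>2 v + \<sigma>\<^sup>2 b ln v) - b (ln u - ln v)\<close>, a combination of convergent terms.
\<close>

lemma critical_growth_imp_race_rate:
  assumes "0 < \<sigma>" "0 < C" and cg: "critical_growth \<sigma> C n1 n2"
    and pos: "\<forall>\<^sub>F m in sequentially. 0 < n1 m"
    and sum: "filterlim (\<lambda>m. n1 m + n2 m) at_top sequentially"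
  shows "filterlim (\<lambda>m. real (n1 m)) at_top sequentially"
    and "(\<lambda>m. race_rate \<sigma> (n1 m) (n2 m)) \<longlonglongrightarrow> exp (- kappa C \<sigma>)"
proof -
  define a b u v where "a = 1 / \<sigma>\<^sup>2" and "b = (1 - a) / 2"
    and "u m = ln (real (n1 m))" and "v m = ln (real (n2 m))" for m
  have s: "0 < \<sigma>\<^sup>2" "a * \<sigma>\<^sup>2 = 1" using assms by (simp_all add: a_def)
  have n2_ge: "\<forall>\<^sub>F m in sequentially. 2 \<le> n2 m"
    using cg by (simp add: critical_growth_def)
  have n2: "filterlim n2 at_top sequentially"
    by (rule critical_growth_second_sample_at_top[OF assms(2) cg sum])
  have v: "filterlim v at_top sequentially"
    unfolding v_def[abs_def]
    by (rule filterlim_compose[OF ln_at_top filterlim_compose[OF filterlim_real_sequentially n2]])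
  have e: "(\<lambda>m. u m - \<sigma>\<^sup>2 * v m + (\<sigma>\<^sup>2 - 1) / 2 * ln (v m)) \<longlonglongrightarrow> ln C"
    using cg unfolding critical_growth_iff_ln[OF assms(2) pos n2_ge] u_def v_def .
  then have e': "(\<lambda>m. u m - \<sigma>\<^sup>2 * v m - (- ((\<sigma>\<^sup>2 - 1) / 2)) * ln (v m)) \<longlonglongrightarrow> ln C"
    by simp
  have u: "filterlim u at_top sequentially" and uv: "(\<lambda>m. ln (u m) - ln (v m)) \<longlonglongrightarrow> ln (\<sigma>\<^sup>2)"
    using log_balance[OF v s(1) e'] by blast+
  have "filterlim (\<lambda>m. exp (u m)) at_top sequentially"
    by (rule filterlim_compose[OF exp_at_top u])
  moreover have "\<forall>\<^sub>F m in sequentially. exp (u m) = real (n1 m)"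
    using pos by eventually_elim (simp add: u_def)
  ultimately show n1: "filterlim (\<lambda>m. real (n1 m)) at_top sequentially"
    by (simp cong: filterlim_cong)
  define t where "t m = ln (tail_transfer \<sigma> (1 / real (n1 m))) + a * u m + b * ln (u m)" for m
  have t: "t \<longlonglongrightarrow> ln \<sigma> - b * ln (4 * pi)"
    using ln_tail_transfer_inverse_nat[OF assms(1) n1]
    unfolding t_def[abs_def] a_def b_def u_def .
  have "(\<lambda>m. exp (t m - a * (u m - \<sigma>\<^sup>2 * v m + (\<sigma>\<^sup>2 - 1) / 2 * ln (v m)) - b * (ln (u m) - ln (v m))))
      \<longlonglongrightarrow> exp (ln \<sigma> - b * ln (4 * pi) - a * ln C - b * ln (\<sigma>\<^sup>2))"
    by (intro tendsto_intros t e uv)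
  moreover have "ln \<sigma> - b * ln (4 * pi) - a * ln C - b * ln (\<sigma>\<^sup>2) = - kappa C \<sigma>"
  proof -
    have "ln (\<sigma>\<^sup>2) = 2 * ln \<sigma>" using assms by (simp add: ln_realpow)
    moreover have "kappa C \<sigma> = a * (ln C - ln \<sigma>) + b * ln (4 * pi)"
      using assms by (simp add: kappa_def a_def b_def ln_divide_pos)
    ultimately show ?thesis by (simp add: b_def field_simps)
  qed
  moreover have "\<forall>\<^sub>F m in sequentially.
      exp (t m - a * (u m - \<sigma>\<^sup>2 * v m + (\<sigma>\<^sup>2 - 1) / 2 * ln (v m)) - b * (ln (u m) - ln (v m)))
      = race_rate \<sigma> (n1 m) (n2 m)"
    using n2_ge
  proof eventually_elim
    case (elim m)
    have b: "a * ((\<sigma>\<^sup>2 - 1) / 2) = b"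
      using s by (simp add: b_def field_simps)
    have "a * (u m - \<sigma>\<^sup>2 * v m + (\<sigma>\<^sup>2 - 1) / 2 * ln (v m))
        = a * u m - (a * \<sigma>\<^sup>2) * v m + (a * ((\<sigma>\<^sup>2 - 1) / 2)) * ln (v m)"
      by (simp only: distrib_left right_diff_distrib mult.assoc)
    then have "t m - a * (u m - \<sigma>\<^sup>2 * v m + (\<sigma>\<^sup>2 - 1) / 2 * ln (v m)) - b * (ln (u m) - ln (v m))
        = ln (tail_transfer \<sigma> (1 / real (n1 m))) + v m"
      unfolding b s by (simp add: t_def algebra_simps)
    then show ?case
      using elim by (simp add: exp_add race_rate_def tail_transfer_pos v_def)
  qed
  ultimately show "(\<lambda>m. race_rate \<sigma> (n1 m) (n2 m)) \<longlonglongrightarrow> exp (- kappa C \<sigma>)"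
    by (auto elim: Lim_transform_eventually)
qed

text \<open>
  The same identity, solved for \<open>u - \<sigma>\<^sup>2 v + \<sigma>\<^sup>2 b ln v\<close>; its limit determines \<open>C\<close>.
\<close>

lemma race_rate_imp_critical_growth:
  assumes "0 < \<sigma>" and n1: "filterlim (\<lambda>m. real (n1 m)) at_top sequentially"
    and d: "(\<lambda>m. race_rate \<sigma> (n1 m) (n2 m)) \<longlonglongrightarrow> c" and c: "0 < c"
  shows "\<exists>C>0. critical_growth \<sigma> C n1 n2"
proof -
  define a b u v where "a = 1 / \<sigma>\<^sup>2" and "b = (1 - a) / 2"
    and "u m = ln (real (n1 m))" and "v m = ln (real (n2 m))" for m
  have s: "0 < a" "\<sigma>\<^sup>2 * a = 1" "\<sigma>\<^sup>2 * b = (\<sigma>\<^sup>2 - 1) / 2"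
    using assms by (simp_all add: a_def b_def field_simps)
  have u: "filterlim u at_top sequentially"
    unfolding u_def[abs_def] by (rule filterlim_compose[OF ln_at_top n1])
  define t where "t m = ln (tail_transfer \<sigma> (1 / real (n1 m))) + a * u m + b * ln (u m)" for m
  define k where "k = ln c - (ln \<sigma> - b * ln (4 * pi))"
  have "t \<longlonglongrightarrow> ln \<sigma> - b * ln (4 * pi)"
    using ln_tail_transfer_inverse_nat[OF assms(1) n1]
    unfolding t_def[abs_def] a_def b_def u_def .
  then have "(\<lambda>m. ln (race_rate \<sigma> (n1 m) (n2 m)) - t m) \<longlonglongrightarrow> k"
    unfolding k_def using c by (intro tendsto_diff tendsto_ln d) auto
  moreover have "\<forall>\<^sub>F m in sequentially. ln (race_rate \<sigma> (n1 m) (n2 m)) - t m = v m - a * u m - b * ln (u m)"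
    using order_tendstoD(1)[OF d c]
  proof eventually_elim
    case (elim m)
    then have "0 < real (n2 m)"
      using tail_transfer_pos[of \<sigma> "1 / real (n1 m)"] by (simp add: race_rate_def zero_less_mult_iff)
    then show ?case
      by (simp add: race_rate_def t_def v_def ln_mult_pos tail_transfer_pos)
  qed
  ultimately have e: "(\<lambda>m. v m - a * u m - b * ln (u m)) \<longlonglongrightarrow> k"
    by (rule Lim_transform_eventually)
  have v: "filterlim v at_top sequentially" and vu: "(\<lambda>m. ln (v m) - ln (u m)) \<longlonglongrightarrow> ln a"
    using log_balance[OF u s(1) e] by blast+
  \<comment> \<open>The exponential of the limit that \<open>e\<close> and \<open>vu\<close> give for the expression in \<open>critical_growth_iff_ln\<close>.\<close>
  define C where "C = exp (- \<sigma>\<^sup>2 * k + \<sigma>\<^sup>2 * b * ln a)"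
  have n1_pos: "\<forall>\<^sub>F m in sequentially. 0 < n1 m"
    using filterlim_at_top_dense[THEN iffD1, OF n1, rule_format, of 0] by eventually_elim simp
  have n2_ge: "\<forall>\<^sub>F m in sequentially. 2 \<le> n2 m"
    using filterlim_at_top_dense[THEN iffD1, OF v, rule_format, of 0]
  proof eventually_elim
    case (elim m)
    show ?case
    proof (rule ccontr)
      assume "\<not> 2 \<le> n2 m"
      then have "n2 m = 0 \<or> n2 m = 1" by auto
      then have "v m = 0" by (auto simp: v_def)
      then show False using elim by simp
    qed
  qed
  have "(\<lambda>m. - \<sigma>\<^sup>2 * (v m - a * u m - b * ln (u m)) + \<sigma>\<^sup>2 * b * (ln (v m) - ln (u m)))
      \<longlonglongrightarrow> - \<sigma>\<^sup>2 * k + \<sigma>\<^sup>2 * b * ln a"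
    by (intro tendsto_intros e vu)
  moreover have "- \<sigma>\<^sup>2 * (v m - a * u m - b * ln (u m)) + \<sigma>\<^sup>2 * b * (ln (v m) - ln (u m))
      = u m - \<sigma>\<^sup>2 * v m + (\<sigma>\<^sup>2 - 1) / 2 * ln (v m)" for m
  proof -
    have "- \<sigma>\<^sup>2 * (v m - a * u m - b * ln (u m)) + \<sigma>\<^sup>2 * b * (ln (v m) - ln (u m))
      = (\<sigma>\<^sup>2 * a) * u m - \<sigma>\<^sup>2 * v m + (\<sigma>\<^sup>2 * b) * ln (v m)"
      by (simp add: algebra_simps)
    then show ?thesis unfolding s by simp
  qed
  ultimately have "(\<lambda>m. u m - \<sigma>\<^sup>2 * v m + (\<sigma>\<^sup>2 - 1) / 2 * ln (v m)) \<longlonglongrightarrow> ln C"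
    by (simp add: C_def)
  then have "critical_growth \<sigma> C n1 n2"
    unfolding u_def v_def by (subst critical_growth_iff_ln) (auto simp: C_def n1_pos n2_ge)
  moreover have "0 < C" by (simp add: C_def)
  ultimately show ?thesis by blast
qed

text \<open>
  The distribution function of \<open>\<Lambda>1 / s + \<kappa>\<close> is \<open>exp (- K x)\<close> with \<open>K x = exp (- s (x - \<kappa>))\<close>, whose
  inverse sends \<open>y\<close> to \<open>\<kappa> - ln y / s\<close>.
\<close>

lemma gumbel_race:
  assumes "prob_space N" "gumbel_variable N \<Lambda>1" "gumbel_variable N \<Lambda>2"
    and ind: "prob_space.indep_var N borel \<Lambda>1 borel \<Lambda>2" and "0 < s"
  shows "\<P>(\<omega> in N. \<Lambda>1 \<omega> > s * (\<Lambda>2 \<omega> - \<kappa>)) = race_limit (1 / s) (exp (- \<kappa>))"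
proof -
  interpret prob_space N by fact
  have [measurable]: "\<Lambda>1 \<in> borel_measurable N" "\<Lambda>2 \<in> borel_measurable N"
    and F: "cdf (distr N borel \<Lambda>1) x = exp (- exp (- x))" "cdf (distr N borel \<Lambda>2) x = exp (- exp (- x))" for x
    using assms by (auto simp: gumbel_variable_def)
  have "indep_var borel ((\<lambda>x. x / s + \<kappa>) \<circ> \<Lambda>1) borel ((\<lambda>x. x) \<circ> \<Lambda>2)"
    by (rule indep_var_compose[OF ind]) auto
  then have ind': "indep_var borel (\<lambda>\<omega>. \<Lambda>1 \<omega> / s + \<kappa>) borel \<Lambda>2"
    by (simp add: comp_def)
  have "\<P>(\<omega> in N. \<Lambda>1 \<omega> > s * (\<Lambda>2 \<omega> - \<kappa>)) = \<P>(\<omega> in N. \<Lambda>2 \<omega> < \<Lambda>1 \<omega> / s + \<kappa>)"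
    using \<open>0 < s\<close> by (intro arg_cong[where f=prob]) (auto simp: field_simps)
  also have "\<dots> = (\<integral>y. exp (- exp (- (\<kappa> - ln y / s))) \<partial>exp_law)"
  proof (rule prob_less_eq_integral_exp_law[OF _ ind', where K="\<lambda>x. exp (- (s * (x - \<kappa>)))"
        and k="\<lambda>y. \<kappa> - ln y / s" and G="\<lambda>x. exp (- exp (- x))"])
    show "prob_space N" by fact
    show "(\<lambda>y. \<kappa> - ln y / s) \<in> borel_measurable borel" by measurable
    show "cdf (distr N borel (\<lambda>\<omega>. \<Lambda>1 \<omega> / s + \<kappa>)) x = exp (- exp (- (s * (x - \<kappa>))))" for x
    proof -
      have "cdf (distr N borel (\<lambda>\<omega>. \<Lambda>1 \<omega> / s + \<kappa>)) x = cdf (distr N borel \<Lambda>1) (s * (x - \<kappa>))"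
        unfolding cdf_def using \<open>0 < s\<close>
        by (subst (1 2) measure_distr) (auto intro!: arg_cong[where f=prob] simp: field_simps)
      then show ?thesis by (simp add: F)
    qed
    show "isCont (\<lambda>x. exp (- exp (- x))) x" for x :: real
      by (intro continuous_intros)
  qed (use \<open>0 < s\<close> in \<open>auto simp: F\<close>)
  also have "\<dots> = race_limit (1 / s) (exp (- \<kappa>))"
    unfolding race_limit_def
  proof (rule integral_cong_AE)
    show "AE y in exp_law. exp (- exp (- (\<kappa> - ln y / s))) = exp (- (exp (- \<kappa>) * y powr (1 / s)))"
      using AE_exp_law_pos by eventually_elim (simp add: powr_def exp_diff exp_minus field_simps)
  qed measurable
  finally show ?thesis .
qed

theorem theorem1:
  fixes \<sigma> :: real
    and n1 n2 :: "nat \<Rightarrow> nat"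
    and P :: "nat \<Rightarrow> 'a measure"
    and X :: "nat \<Rightarrow> nat \<Rightarrow> 'a \<Rightarrow> real"
  defines "p \<equiv> (\<lambda>m. \<P>(\<omega> in P m.
      (MAX i\<in>{1..n1 m}. X m i \<omega>) > (MAX i\<in>{n1 m + 1..n1 m + n2 m}. X m i \<omega>)))"
  assumes "\<sigma> > 1"
    and "\<And>m. m \<ge> 1 \<Longrightarrow> n1 m > 0"
    and "\<And>m. m \<ge> 1 \<Longrightarrow> n2 m > 0"
    and "filterlim (\<lambda>m. n1 m + n2 m) at_top sequentially"
    and "\<And>m. m \<ge> 1 \<Longrightarrow> prob_space (P m)"
    and "\<And>m i. m \<ge> 1 \<Longrightarrow> i \<in> {1..n1 m} \<Longrightarrow>
           distributed (P m) lborel (X m i) (normal_density 0 1)"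
    and "\<And>m i. m \<ge> 1 \<Longrightarrow> i \<in> {n1 m + 1..n1 m + n2 m} \<Longrightarrow>
           distributed (P m) lborel (X m i) (normal_density 0 \<sigma>)"
    and "\<And>m. m \<ge> 1 \<Longrightarrow>
           prob_space.indep_vars (P m) (\<lambda>_. borel) (X m) {1..n1 m + n2 m}"
  shows "((\<exists>L. 0 < L \<and> L < 1 \<and> p \<longlonglongrightarrow> L) \<longleftrightarrow> (\<exists>C>0. critical_growth \<sigma> C n1 n2)) \<and>
    (\<forall>C>0. critical_growth \<sigma> C n1 n2 \<longrightarrow>
       p \<longlonglongrightarrow> (LBINT y:{0..}. exp (- y - exp (- kappa C \<sigma>) * y powr (1 / \<sigma>\<^sup>2))) \<and>
       (\<forall>(N :: 'b measure) \<Lambda>1 \<Lambda>2.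
          prob_space N \<and> gumbel_variable N \<Lambda>1 \<and> gumbel_variable N \<Lambda>2 \<and>
          prob_space.indep_var N borel \<Lambda>1 borel \<Lambda>2 \<longrightarrow>
          \<P>(\<omega> in N. \<Lambda>1 \<omega> > \<sigma>\<^sup>2 * (\<Lambda>2 \<omega> - kappa C \<sigma>)) =
            (LBINT y:{0..}. exp (- y - exp (- kappa C \<sigma>) * y powr (1 / \<sigma>\<^sup>2)))))"
proof -
  have \<sigma>: "0 < \<sigma>" using assms(2) by simp
  have ev: "\<forall>\<^sub>F m in sequentially. 1 \<le> m" by (rule eventually_ge_at_top)
  have n1_pos: "\<forall>\<^sub>F m in sequentially. 0 < n1 m"
    using ev by eventually_elim (rule assms(3))
  have p_eq: "p m = race_prob \<sigma> (n1 m) (n2 m)" if m: "1 \<le> m" for m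
  proof -
    have un: "{1..n1 m} \<union> {n1 m + 1..n1 m + n2 m} = {1..n1 m + n2 m}" by auto
    have "p m = (\<integral>y. exp (- (real (card {n1 m + 1..n1 m + n2 m})
        * tail_transfer \<sigma> (y / real (card {1..n1 m})))) \<partial>exp_law)"
      unfolding p_def
    proof (rule prob_max_greater[OF assms(6)[OF m] \<sigma>])
      show "prob_space.indep_vars (P m) (\<lambda>_. borel) (X m) ({1..n1 m} \<union> {n1 m + 1..n1 m + n2 m})"
        unfolding un by (rule assms(9)[OF m])
    qed (use assms(3,4)[OF m] assms(7,8)[OF m] in auto)
    then show ?thesis by (simp add: race_prob_def)
  qed
  have p: "p \<longlonglongrightarrow> L \<longleftrightarrow> (\<lambda>m. race_prob \<sigma> (n1 m) (n2 m)) \<longlonglongrightarrow> L" for L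
    by (rule tendsto_cong) (rule eventually_mono[OF ev p_eq])
  have forward: "p \<longlonglongrightarrow> race_limit (1 / \<sigma>\<^sup>2) (exp (- kappa C \<sigma>))"
    if "0 < C" "critical_growth \<sigma> C n1 n2" for C
    unfolding p
    using critical_growth_imp_race_rate[OF \<sigma> that n1_pos assms(5)]
    by (rule race_prob_tendsto[OF \<sigma>])
  have "\<exists>C>0. critical_growth \<sigma> C n1 n2" if L: "0 < L" "L < 1" "p \<longlonglongrightarrow> L" for L
  proof -
    note lim = L(3)[unfolded p]
    have "filterlim n1 at_top sequentially"
      by (rule first_sample_at_top[OF \<sigma> n1_pos assms(5) lim L(1)])
    then have n1: "filterlim (\<lambda>m. real (n1 m)) at_top sequentially"
      by (rule filterlim_compose[OF filterlim_real_sequentially])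
    obtain c where "0 < c" "(\<lambda>m. race_rate \<sigma> (n1 m) (n2 m)) \<longlonglongrightarrow> c"
      using race_rate_tendsto[OF \<sigma> n1 lim L(1,2)] by blast
    then show ?thesis
      using race_rate_imp_critical_growth[OF \<sigma> n1] by blast
  qed
  moreover have "\<exists>L. 0 < L \<and> L < 1 \<and> p \<longlonglongrightarrow> L" if "0 < C" "critical_growth \<sigma> C n1 n2" for C
    using forward[OF that] race_limit_bounds[of "exp (- kappa C \<sigma>)" "1 / \<sigma>\<^sup>2"] by auto
  moreover have "\<P>(\<omega> in N. \<Lambda>1 \<omega> > \<sigma>\<^sup>2 * (\<Lambda>2 \<omega> - kappa C \<sigma>)) = race_limit (1 / \<sigma>\<^sup>2) (exp (- kappa C \<sigma>))"
    if "prob_space N" "gumbel_variable N \<Lambda>1" "gumbel_variable N \<Lambda>2"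
      "prob_space.indep_var N borel \<Lambda>1 borel \<Lambda>2" for N :: "'b measure" and \<Lambda>1 \<Lambda>2 C
    using gumbel_race[OF that] \<sigma> by simp
  ultimately show ?thesis
    using forward unfolding race_limit_eq by blast
qed

end
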